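(* For each integer $s$ with $1 \leq s \leq 5$, there exists an $O$-sequence $(h_0, h_1, \ldots, h_{2s-1}) \in \mathbb{Z}_{\geq 0}^{2s}$ satisfying (i) $h_0 \leq h_1 \leq \cdots \leq h_{s-1}$, (ii) $h_{2s-1} = h_0$ and $h_{2s-2} = h_1$, and (iii) $h_{2s-1-i} = h_i + (-1)^i$ for all $2 \leq i \leq s-1$, which is the $h$-vector of a Cohen--Macaulay standard $G$-domain.
   Context: A standard $G$-algebra is a Noetherian commutative graded ring $A = \bigoplus_{n=0}^{\infty} A_n$ such that $A_0 = K$ is a field, $A = K[A_1]$ (i.e. $A$ is generated by $A_1$ as a $K$-algebra), and $\dim_K A_1 < \infty$. A standard $G$-domain is a standard $G$-algebra which is an integral domain. The Hilbert function of $A$ is $H(A,n) = \dim_K A_n$ for $n = 0,1,2,\ldots$. Let $d = \dim A$ be the Krull dimension. The $h$-vector of $A$ is the sequence $h(A) = (h_0,h_1,h_2,\ldots)$ defined by $$(1-\lambda)^d \sum_{n=0}^{\infty} H(A,n)\lambda^n = \sum_{i=0}^{\infty} h_i \lambda^i .$$ It has finitely many non-zero terms; if $h_i = 0$ for all $i > t$ and $h_t \neq 0$, one writes $h(A) = (h_0,h_1,\ldots,h_t)$. A non-empty set $M$ of monomials in variables $Y_1,\ldots,Y_r$ is an order ideal of monomials if, whenever $m \in M$ and $m'$ divides $m$, then $m' \in M$. A finite sequence $(h_0,h_1,\ldots,h_t)$ of non-negative integers is an $O$-sequence if there exists an order ideal $M$ of monomials in some variables $Y_1,\ldots,Y_r$,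 each of degree $1$, such that $h_j = |\{m \in M : \deg m = j\}|$ for all $0 \leq j \leq t$. In particular $h_0 = 1$. *)

theory Defs
  imports
    "HOL-Algebra.Ring_Divisibility"
    "HOL-Algebra.Embedded_Algebras"
    "HOL-Algebra.Generated_Rings"
    "HOL-Computational_Algebra.Formal_Power_Series"
    "HOL-Computational_Algebra.Polynomial"
    "HOL-Library.Extended_Nat"
    "HOL-Library.Multiset"
    Complex_Main
begin

section \<open>Krull dimension and Cohen--Macaulay rings\<close>

definition prime_chain :: "('a, 'b) ring_scheme \<Rightarrow> nat \<Rightarrow> (nat \<Rightarrow> 'a set) \<Rightarrow> bool" where
  "prime_chain R n P \<longleftrightarrow> (\<forall>i\<le>n. primeideal (P i) R) \<and> (\<forall>i<n. P i \<subset> P (Suc i))"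

definition krull_dim :: "('a, 'b) ring_scheme \<Rightarrow> enat" where
  "krull_dim R = Sup {enat n | n. \<exists>P. prime_chain R n P}"

definition prime_height :: "('a, 'b) ring_scheme \<Rightarrow> 'a set \<Rightarrow> enat" where
  "prime_height R Q = Sup {enat n | n. \<exists>P. prime_chain R n P \<and> P n = Q}"

definition regular_sequence :: "('a, 'b) ring_scheme \<Rightarrow> 'a list \<Rightarrow> bool" where
  "regular_sequence R xs \<longleftrightarrow>
     set xs \<subseteq> carrier R \<and>
     Idl\<^bsub>R\<^esub> (set xs) \<noteq> carrier R \<and>
     (\<forall>i<length xs. \<forall>y\<in>carrier R.
        xs ! i \<otimes>\<^bsub>R\<^esub> y \<in> Idl\<^bsub>R\<^esub> (set (take i xs)) \<longrightarrow> y \<in> Idl\<^bsub>R\<^esub> (set (take i xs)))"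

definition ideal_depth :: "('a, 'b) ring_scheme \<Rightarrow> 'a set \<Rightarrow> enat" where
  "ideal_depth R I = Sup {enat (length xs) | xs. regular_sequence R xs \<and> set xs \<subseteq> I}"

text \<open>
  The definition of Kaplansky and of Eisenbud: in a Noetherian commutative ring, depth equals
  codimension for every maximal ideal.
\<close>

definition cohen_macaulay :: "('a, 'b) ring_scheme \<Rightarrow> bool" where
  "cohen_macaulay R \<longleftrightarrow>
     cring R \<and> noetherian_ring R \<and>
     (\<forall>Q. maximalideal Q R \<longrightarrow> ideal_depth R Q = prime_height R Q)"


section \<open>Standard \<open>G\<close>-algebras and their \<open>h\<close>-vectors\<close>

locale standard_G_algebra = noetherian_ring R + cring R
  for R :: "('a, 'b) ring_scheme" (structure) and A :: "nat \<Rightarrow> 'a set" +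
  assumes component_subgroup: "additive_subgroup (A n) R"
    and component_mult: "\<lbrakk>x \<in> A m; y \<in> A n\<rbrakk> \<Longrightarrow> x \<otimes> y \<in> A (m + n)"
    and direct_sum: "x \<in> carrier R \<Longrightarrow>
      \<exists>!f. (\<forall>n. f n \<in> A n) \<and> finite {n. f n \<noteq> \<zero>} \<and> x = finsum R f {n. f n \<noteq> \<zero>}"
    and base_field: "subfield (A 0) R"
    and generated_in_degree_one: "generate_ring R (A 0 \<union> A 1) = carrier R"
    and finite_dim_degree_one: "finite_dimension (A 0) (A 1)"

locale standard_G_domain = standard_G_algebra + domain R

definition hilbert_fun :: "('a, 'b) ring_scheme \<Rightarrow> (nat \<Rightarrow> 'a set) \<Rightarrow> nat \<Rightarrow> nat" where
  "hilbert_fun R A n = ring.dim R (A 0) (A n)"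

definition h_series :: "('a, 'b) ring_scheme \<Rightarrow> (nat \<Rightarrow> 'a set) \<Rightarrow> int fps" where
  "h_series R A =
     (1 - fps_X) ^ the_enat (krull_dim R) * Abs_fps (\<lambda>n. int (hilbert_fun R A n))"

text \<open>The equation \<open>h(A) = (h\<^sub>0, \<dots>, h\<^sub>t)\<close>, which includes \<open>h\<^sub>t \<noteq> 0\<close>.\<close>

definition is_h_vector :: "('a, 'b) ring_scheme \<Rightarrow> (nat \<Rightarrow> 'a set) \<Rightarrow> nat list \<Rightarrow> bool" where
  "is_h_vector R A h \<longleftrightarrow>
     h \<noteq> [] \<and> last h \<noteq> 0 \<and>
     (\<forall>i. fps_nth (h_series R A) i = (if i < length h then int (h ! i) else 0))"


section \<open>\<open>O\<close>-sequences\<close>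

text \<open>
  A monomial in \<open>Y\<^sub>1, \<dots>, Y\<^sub>r\<close> is the multiset of the indices of its variables: divisibility is
  inclusion of multisets and the degree is the size.
\<close>

definition order_ideal_of_monomials :: "nat \<Rightarrow> nat multiset set \<Rightarrow> bool" where
  "order_ideal_of_monomials r M \<longleftrightarrow>
     M \<noteq> {} \<and> (\<forall>m\<in>M. set_mset m \<subseteq> {1..r}) \<and> (\<forall>m\<in>M. \<forall>m'. m' \<subseteq># m \<longrightarrow> m' \<in> M)"

definition O_sequence :: "nat list \<Rightarrow> bool" where
  "O_sequence h \<longleftrightarrow>
     h \<noteq> [] \<and>
     (\<exists>r M. order_ideal_of_monomials r M \<and>
        (\<forall>j<length h. h ! j = card {m \<in> M. size m = j}))"


section \<open>The ambient type\<close>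

text \<open>
  HOL cannot quantify existentially over types, so rings asserted to exist have their carrier,
  with arbitrary operations, inside one fixed type. Any infinite type serves equally well for the
  existence of a Cohen--Macaulay standard \<open>G\<close>-domain with a given \<open>h\<close>-vector: such a domain
  \<open>K[x\<^sub>1, \<dots>, x\<^sub>n]/I\<close> descends, with the same \<open>h\<close>-vector, to the countable subfield of \<open>K\<close>
  generated by the coefficients of finitely many generators of \<open>I\<close>, and then has a countable carrier.
\<close>

type_synonym ambient = "complex poly"

end

theory Submission
  imports Defs "HOL-Library.Multiset_Order"
    "HOL-Computational_Algebra.Fundamental_Theorem_Algebra"
begin

text \<open>
  A domain of Krull dimension one is Cohen--Macaulay, so it suffices to look for graded domains
  of dimension one over a field that is not algebraically closed. Let \<open>L = \<rat>(\<alpha>)\<close> with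
  \<open>\<alpha>\<^sup>N = 2\<close>. Since \<open>X\<^sup>N - 2\<close> is irreducible over \<open>\<rat>\<close> (\<open>degree_of_root_of_2\<close>), the powers
  \<open>\<alpha>\<^sup>k\<close> with \<open>k < N\<close> are a basis of \<open>L\<close>, and up to rational factors they multiply like the
  elements of \<open>\<int>/N\<close>. For a set \<open>S \<subseteq> \<int>/N\<close> containing \<open>0\<close> let \<open>V\<^sub>n\<close> be the span of the
  \<open>\<alpha>\<^sup>k\<close> with \<open>k\<close> in the \<open>n\<close>-fold sumset \<open>nS\<close>. Then \<open>\<Oplus>\<^sub>n V\<^sub>n X\<^sup>n \<subseteq> L[X]\<close> is a domain,
  generated by its elements of degree one over \<open>V\<^sub>0 = \<rat>\<close>, with Hilbert function \<open>n \<mapsto> |nS|\<close>.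

  If \<open>tS = \<int>/N\<close>, then \<open>V\<^sub>n = L\<close> for all \<open>n \<ge> t\<close>, and so division by a non-zero element \<open>f\<close> is
  possible down to degree \<open>deg f + t\<close> (\<open>division\<close>): modulo \<open>f\<close> the ring is finite-dimensional
  over \<open>\<rat>\<close>. Everything else about the ring follows from that. Ideals are finitely generated, and
  each \<open>y\<close> satisfies \<open>y\<^sup>j (1 + y z) \<in> (f)\<close> for some \<open>j\<close> and \<open>z\<close> (\<open>power_relation\<close>), so that
  modulo a non-zero prime every \<open>y \<noteq> 0\<close> is a unit and no regular sequence has length two.
  Hence the dimension, the height of every maximal ideal and its depth are all one, and the
  \<open>h\<close>-vector is \<open>h\<^sub>n = |nS| - |(n-1)S|\<close>, the number of residues at distance \<open>n\<close> from \<open>0\<close>. It is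
  an \<open>O\<close>-sequence, because the monomials in the non-zero elements of \<open>S\<close> that are the least
  representatives of their residues form an order ideal (\<open>O_sequence_layers\<close>).

  What remains is a choice of \<open>S\<close>. The set of the \<open>(3\<^sup>k - 1) / 2\<close> with \<open>k < s\<close> modulo
  \<open>N = (3\<^sup>s - 1) / 2\<close> works for \<open>2 \<le> s \<le> 5\<close>, and its distances are checked by computation.
\<close>

section \<open>Iterated sumsets in a cyclic group\<close>

primrec sumset :: "nat \<Rightarrow> nat set \<Rightarrow> nat \<Rightarrow> nat set" where
  "sumset N S 0 = {0}"
| "sumset N S (Suc n) = (\<lambda>(a, b). (a + b) mod N) ` (S \<times> sumset N S n)"

text \<open>
  The residues at distance exactly \<open>n\<close> from \<open>0\<close> in the directed Cayley graph of \<open>\<int>/N\<close> with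
  steps from \<open>S\<close>.
\<close>

definition layer :: "nat \<Rightarrow> nat set \<Rightarrow> nat \<Rightarrow> nat set" where
  "layer N S n = sumset N S n - (\<Union>i<n. sumset N S i)"

lemma sumset_less: "0 < N \<Longrightarrow> k \<in> sumset N S n \<Longrightarrow> k < N"
  by (cases n) auto

lemma sumset_SucI: "a \<in> S \<Longrightarrow> b \<in> sumset N S n \<Longrightarrow> (a + b) mod N \<in> sumset N S (Suc n)"
  by force

lemma finite_sumset: "0 < N \<Longrightarrow> finite (sumset N S n)"
  by (rule finite_subset[of _ "{..<N}"]) (auto dest: sumset_less)

lemma sumset_mono:
  assumes "0 < N" "0 \<in> S" "m \<le> n"
  shows "sumset N S m \<subseteq> sumset N S n"
  using assms(3)
proof (induction rule: dec_induct)
  case (step n)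
  have "sumset N S n \<subseteq> sumset N S (Suc n)"
  proof
    fix k assume k: "k \<in> sumset N S n"
    hence "(0 + k) mod N = k"
      using sumset_less[OF assms(1) k] by simp
    thus "k \<in> sumset N S (Suc n)"
      using k assms(2) by force
  qed
  with step show ?case by blast
qed simp

lemma sumset_add:
  assumes "0 < N" "a \<in> sumset N S m" "b \<in> sumset N S n"
  shows "(a + b) mod N \<in> sumset N S (m + n)"
  using assms(2)
proof (induction m arbitrary: a)
  case 0
  with sumset_less[OF assms(1,3)] assms(3) show ?case by simp
next
  case (Suc m)
  then obtain x y where xy: "x \<in> S" "y \<in> sumset N S m" "a = (x + y) mod N"
    by auto
  have "(x + (y + b) mod N) mod N = (a + b) mod N"
    unfolding xy(3) by (simp add: mod_simps add.assoc)
  with sumset_SucI[OF xy(1) Suc.IH[OF xy(2)]] show ?case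
    by simp
qed

lemma card_layer_0: "card (layer N S 0) = 1"
  by (simp add: layer_def)

lemma card_layer_Suc:
  assumes "0 < N" "0 \<in> S"
  shows "card (layer N S (Suc n)) + card (sumset N S n) = card (sumset N S (Suc n))"
proof -
  have "(\<Union>i<Suc n. sumset N S i) = sumset N S n"
  proof
    show "(\<Union>i<Suc n. sumset N S i) \<subseteq> sumset N S n"
      using sumset_mono[OF assms, of _ n] by (intro UN_least) (simp del: sumset.simps)
  qed blast
  hence "layer N S (Suc n) = sumset N S (Suc n) - sumset N S n"
    by (simp only: layer_def)
  moreover have "sumset N S n \<subseteq> sumset N S (Suc n)"
    using sumset_mono[OF assms, of n "Suc n"] by (simp del: sumset.simps)
  ultimately show ?thesis
    using finite_sumset[OF assms(1)]
    by (metis card_Diff_subset card_mono le_add_diff_inverse2)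
qed

text \<open>
  A list \<open>D\<close> is the list of distances from \<open>0\<close> as soon as it satisfies Bellman's equation
  \<open>D(k) = 1 + min D(k - a)\<close> for \<open>k \<noteq> 0\<close>, because all steps have positive length. Subtraction of
  \<open>a\<close> is a rotation of the list, which makes the equation cheap to evaluate.
\<close>

lemma sumset_by_distance:
  fixes D :: "nat list"
  assumes as: "\<forall>a\<in>set as. a \<le> N" "0 \<in> set as"
    and len: "length D = N" "0 < N"
    and D: "D = (map Suc (fold (map2 min) (map (\<lambda>a. rotate (N - a) D) as) D))[0 := 0]"
  shows "sumset N (set as) n = {k. k < N \<and> D ! k \<le> n}"
proof -
  have len_fold: "length (fold (map2 min) (map (\<lambda>a. rotate (N - a) D) bs) E) = N"
    if "length E = N" for bs and E :: "nat list"
    using that by (induction bs arbitrary: E) (simp_all add: len)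
  have fold_le: "fold (map2 min) (map (\<lambda>a. rotate (N - a) D) bs) E ! k \<le> n \<longleftrightarrow>
      E ! k \<le> n \<or> (\<exists>a\<in>set bs. D ! ((k + (N - a)) mod N) \<le> n)"
    if "length E = N" "k < N" for bs k n and E :: "nat list"
    using that
    by (induction bs arbitrary: E) (auto simp: len nth_rotate add.commute)
  have D0: "D ! 0 = 0"
    by (subst D) (use len len_fold[OF len(1)] in \<open>simp add: nth_list_update\<close>)
  have DS: "D ! k \<le> Suc n \<longleftrightarrow> (\<exists>a\<in>set as. D ! ((k + (N - a)) mod N) \<le> n)"
    and Dpos: "D ! k \<noteq> 0"
    if "k < N" "k \<noteq> 0" for k n
  proof -
    have Dk: "D ! k = Suc (fold (map2 min) (map (\<lambda>a. rotate (N - a) D) as) D ! k)"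
      by (subst (1) D) (use that len len_fold[OF len(1)] in \<open>simp add: nth_list_update\<close>)
    have "D ! k \<le> n \<Longrightarrow> \<exists>a\<in>set as. D ! ((k + (N - a)) mod N) \<le> n"
      using as(2) that by (intro bexI[of _ 0]) auto
    thus "D ! k \<le> Suc n \<longleftrightarrow> (\<exists>a\<in>set as. D ! ((k + (N - a)) mod N) \<le> n)"
      unfolding Dk Suc_le_mono fold_le[OF len(1) that(1)] by (auto simp: Dk fold_le len that)
    show "D ! k \<noteq> 0" using Dk by simp
  qed
  show ?thesis
  proof (induction n)
    case 0
    have "k = 0" if "k < N" "D ! k = 0" for k
      using Dpos[OF that(1)] that(2) by blast
    thus ?case using D0 len by auto
  next
    case (Suc n)
    show ?case
    proof (intro equalityI subsetI)
      fix k assume "k \<in> sumset N (set as) (Suc n)"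
      then obtain a b where ab: "a \<in> set as" "b < N" "D ! b \<le> n" "k = (a + b) mod N"
        using Suc.IH by auto
      have "(k + (N - a)) mod N = (a + b + (N - a)) mod N"
        by (simp add: ab(4) mod_simps)
      also have "a + b + (N - a) = b + N" using as(1) ab(1) by auto
      finally have "(k + (N - a)) mod N = b" using ab(2) by simp
      hence "k = 0 \<or> D ! k \<le> Suc n"
        using DS[of k n] ab len by (metis mod_less_divisor)
      thus "k \<in> {k. k < N \<and> D ! k \<le> Suc n}"
        using ab(4) len D0 by auto
    next
      fix k assume k: "k \<in> {k. k < N \<and> D ! k \<le> Suc n}"
      have "\<exists>a\<in>set as. D ! ((k + (N - a)) mod N) \<le> n"
      proof (cases "k = 0")
        case True
        with as(2) D0 show ?thesis by (intro bexI[of _ 0]) auto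
      qed (use DS k in auto)
      then obtain a where a: "a \<in> set as" "D ! ((k + (N - a)) mod N) \<le> n" ..
      have "(a + (k + (N - a)) mod N) mod N = (k + (a + (N - a))) mod N"
        by (simp add: mod_simps add.left_commute)
      also have "\<dots> = k" using as(1) a(1) k by auto
      finally have "k = (a + (k + (N - a)) mod N) mod N" ..
      moreover have "(k + (N - a)) mod N \<in> sumset N (set as) n"
        using Suc.IH a(2) len by simp
      ultimately show "k \<in> sumset N (set as) (Suc n)"
        using sumset_SucI[OF a(1)] by metis
    qed
  qed
qed

lemma card_layer_by_distance:
  assumes "\<And>n. sumset N S n = {k. k < N \<and> D ! k \<le> n}" "length D = N"
  shows "card (layer N S n) = count_list D n"
proof -
  have "layer N S n = {k. k < length D \<and> n = D ! k}"
    unfolding layer_def assms by (force simp: assms(2) order_le_less)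
  thus ?thesis
    by (simp add: count_list_eq_length_filter length_filter_conv_card)
qed

section \<open>Standard monomials\<close>

text \<open>
  This is Macaulay's argument for standard monomials. Represent the residues by monomials
  whose variables are the non-zero elements of \<open>S\<close>, and compare monomials first by degree and
  then by the multiset order. Both are compatible with multiplication, so a divisor of a least
  representative of its residue is itself least; and each residue of a layer has exactly one least
  representative, whose degree is the index of the layer.
\<close>

lemma O_sequence_layers:
  assumes N: "0 < N" and S: "finite S" "0 \<in> S" and l: "0 < l"
  shows "O_sequence (map (\<lambda>j. card (layer N S j)) [0..<l])"
proof -
  obtain w where w: "bij_betw w {1..card (S - {0})} (S - {0})"
    using ex_bij_betw_nat_finite_1[of "S - {0}"] S by auto
  define r where "r = card (S - {0})"
  define Mon where "Mon = {m :: nat multiset. set_mset m \<subseteq> {1..r}}"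
  define wt where "wt = (\<lambda>m. sum_mset (image_mset w m) mod N)"
  have w_img: "w ` {1..r} = S - {0}"
    using w by (simp add: bij_betw_def r_def)
  have wt_add: "wt (m + d) = (wt m + wt d) mod N" for m d
    by (simp add: wt_def mod_simps)
  have sumset_eq: "sumset N S n = wt ` {m \<in> Mon. size m \<le> n}" for n
  proof (induction n)
    case 0
    show ?case by (auto simp: wt_def Mon_def image_iff intro!: exI[of _ "{#}"])
  next
    case (Suc n)
    show ?case
    proof (intro equalityI subsetI)
      fix k assume "k \<in> sumset N S (Suc n)"
      then obtain a m where am: "a \<in> S" "m \<in> Mon" "size m \<le> n" "k = (a + wt m) mod N"
        using Suc.IH by auto
      show "k \<in> wt ` {m \<in> Mon. size m \<le> Suc n}"
      proof (cases "a = 0")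
        case True
        with am(4) have "k = wt m" by (simp add: wt_def)
        moreover have "m \<in> {m \<in> Mon. size m \<le> Suc n}" using am by simp
        ultimately show ?thesis by (rule image_eqI)
      next
        case False
        hence "a \<in> w ` {1..r}" using am(1) unfolding w_img by simp
        then obtain i where i: "i \<in> {1..r}" "w i = a" by blast
        have "k = wt (add_mset i m)"
          unfolding wt_def am(4) i(2)[symmetric] by (simp add: mod_simps)
        moreover have "add_mset i m \<in> {m \<in> Mon. size m \<le> Suc n}"
          using i am by (auto simp: Mon_def)
        ultimately show ?thesis by (rule image_eqI)
      qed
    next
      fix k assume "k \<in> wt ` {m \<in> Mon. size m \<le> Suc n}"
      then obtain m where m: "m \<in> Mon" "size m \<le> Suc n" "k = wt m" by auto
      show "k \<in> sumset N S (Suc n)"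
      proof (cases m)
        case empty
        hence "k \<in> sumset N S 0" using m by (simp add: wt_def)
        thus ?thesis using sumset_mono[OF N S(2), of 0 "Suc n"] by blast
      next
        case (add i m')
        have "i \<in> {1..r}" using m(1) by (simp add: Mon_def add)
        hence "w i \<in> S" using w_img by blast
        moreover have "wt m' \<in> sumset N S n"
          unfolding Suc.IH using m add by (auto simp: Mon_def)
        moreover have "k = (w i + wt m') mod N"
          by (simp add: m(3) add wt_def mod_simps)
        ultimately show ?thesis using sumset_SucI by metis
      qed
    qed
  qed
  define M where "M = {m \<in> Mon. \<forall>m'\<in>Mon. wt m' = wt m \<longrightarrow>
    size m < size m' \<or> size m = size m' \<and> m \<le> m'}"
  have "order_ideal_of_monomials r M"
    unfolding order_ideal_of_monomials_def
  proof (intro conjI ballI allI impI)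
    show "M \<noteq> {}"
    proof -
      have "{#} \<in> M" by (auto simp: M_def Mon_def nonempty_has_size)
      thus ?thesis by blast
    qed
    show "set_mset m \<subseteq> {1..r}" if "m \<in> M" for m
      using that by (auto simp: M_def Mon_def)
    fix m m1 assume m: "m \<in> M" and "m1 \<subseteq># m"
    then obtain d where d: "m = m1 + d" by (auto simp: mset_subset_eq_exists_conv)
    show "m1 \<in> M"
      unfolding M_def
    proof (intro CollectI conjI ballI impI)
      show "m1 \<in> Mon" using m d by (auto simp: M_def Mon_def)
      fix m' assume m': "m' \<in> Mon" "wt m' = wt m1"
      have "m' + d \<in> Mon" using m d m' by (auto simp: M_def Mon_def)
      moreover have "wt (m' + d) = wt m" by (simp add: wt_add d m'(2))
      ultimately have "size m < size (m' + d) \<or> size m = size (m' + d) \<and> m \<le> m' + d"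
        using m by (auto simp: M_def)
      thus "size m1 < size m' \<or> size m1 = size m' \<and> m1 \<le> m'"
        by (simp add: d)
    qed
  qed
  moreover have "card (layer N S j) = card {m \<in> M. size m = j}" for j
  proof -
    have minimal: "m \<le> m'" if "m \<in> M" "m' \<in> M" "size m = size m'" "wt m = wt m'" for m m'
    proof -
      have "size m < size m' \<or> size m = size m' \<and> m \<le> m'"
        using that(1,2,4) unfolding M_def by auto
      with that(3) show ?thesis by simp
    qed
    have "inj_on wt {m \<in> M. size m = j}"
      by (intro inj_onI order.antisym; rule minimal) auto
    moreover have "wt ` {m \<in> M. size m = j} = layer N S j"
    proof (intro equalityI subsetI)
      fix k assume "k \<in> wt ` {m \<in> M. size m = j}"
      then obtain m where m: "m \<in> M" "size m = j" "k = wt m" by blast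
      have "k \<in> sumset N S j"
        unfolding sumset_eq m(3) using m by (intro imageI) (simp add: M_def)
      moreover have "k \<notin> sumset N S i" if "i < j" for i
      proof
        assume "k \<in> sumset N S i"
        then obtain m' where m': "m' \<in> Mon" "size m' \<le> i" "wt m' = wt m"
          unfolding sumset_eq m(3) by force
        with m(1) have "size m \<le> size m'" by (auto simp: M_def)
        with m' m(2) that show False by simp
      qed
      ultimately show "k \<in> layer N S j" by (simp add: layer_def)
    next
      fix k assume k: "k \<in> layer N S j"
      define P where "P = (\<lambda>m. m \<in> Mon \<and> size m = j \<and> wt m = k)"
      have size_ge: "j \<le> size m" if "m \<in> Mon" "wt m = k" for m
      proof (rule ccontr)
        assume "\<not> j \<le> size m"
        moreover have "wt m \<in> sumset N S (size m)"
          unfolding sumset_eq using that by (intro imageI) simp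
        ultimately show False using k that by (auto simp: layer_def)
      qed
      have "k \<in> wt ` {m \<in> Mon. size m \<le> j}"
        using k unfolding layer_def sumset_eq by simp
      then obtain m0 where "m0 \<in> Mon" "size m0 \<le> j" "wt m0 = k" by blast
      hence "P m0" using size_ge[of m0] by (simp add: P_def)
      hence P: "P (LEAST m. P m)" by (rule LeastI)
      have "(LEAST m. P m) \<in> M"
        unfolding M_def
      proof (intro CollectI conjI ballI impI)
        show "(LEAST m. P m) \<in> Mon" using P by (simp add: P_def)
        fix m' assume m': "m' \<in> Mon" "wt m' = wt (LEAST m. P m)"
        have "wt m' = k" using m'(2) P by (simp add: P_def)
        moreover have "(LEAST m. P m) \<le> m'" if "P m'" using that by (rule Least_le)
        ultimately show "size (LEAST m. P m) < size m' \<or>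
            size (LEAST m. P m) = size m' \<and> (LEAST m. P m) \<le> m'"
          using m'(1) size_ge[of m'] P by (auto simp: P_def order.order_iff_strict)
      qed
      hence "wt (LEAST m. P m) \<in> wt ` {m \<in> M. size m = j}"
        using P by (intro imageI) (simp add: P_def)
      thus "k \<in> wt ` {m \<in> M. size m = j}"
        using P by (simp add: P_def)
    qed
    ultimately show ?thesis by (metis card_image)
  qed
  ultimately show ?thesis
    using l unfolding O_sequence_def by auto
qed

section \<open>Radicals of 2\<close>

lemma rational_power_eq_2_power:
  fixes r :: rat
  assumes "0 < N" "r ^ N = 2 ^ d" "0 \<le> r"
  shows "N dvd d"
proof -
  obtain a b where ab: "r = of_int a / of_int b" "b > 0" "coprime a b"
    by (metis quotient_of_coprime quotient_of_denom_pos quotient_of_div surj_pair)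
  have "(of_int (a ^ N) :: rat) = of_int (2 ^ d * b ^ N)"
    using assms(2) ab by (simp add: power_divide field_simps)
  hence eq: "a ^ N = 2 ^ d * b ^ N" by (simp only: of_int_eq_iff)
  hence "b ^ N dvd a ^ N" by simp
  moreover have "coprime (a ^ N) (b ^ N)" using ab(3) by simp
  ultimately have "is_unit (b ^ N)" by (metis coprime_absorb_right)
  hence "b ^ N = 1" using ab(2) by simp
  with eq have eq: "a ^ N = 2 ^ d" by simp
  hence "a \<noteq> 0" using assms(1) by (metis power_eq_0_iff zero_neq_numeral)
  have "multiplicity 2 (a ^ N) = N * multiplicity 2 a"
    using \<open>a \<noteq> 0\<close> by (intro prime_elem_multiplicity_power_distrib) auto
  moreover have "multiplicity 2 (2 ^ d :: int) = d"
    by (intro multiplicity_same_power) auto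
  ultimately have "N * multiplicity 2 a = d" using eq by simp
  thus ?thesis by auto
qed

text \<open>
  Irreducibility of \<open>X\<^sup>N - 2\<close> over \<open>\<rat>\<close>, by the norm: all complex roots of \<open>X\<^sup>N - 2\<close> have
  the same absolute value, the \<open>N\<close>-th root of \<open>2\<close>, so for a monic factor \<open>g\<close> the number
  \<open>|g(0)|\<close> is the power of that root with exponent \<open>deg g\<close>. It is rational only if \<open>N\<close>
  divides \<open>deg g\<close>.
\<close>

lemma degree_of_root_of_2:
  fixes \<alpha> :: complex and p :: "complex poly"
  assumes N: "0 < N" "\<alpha> ^ N = 2"
    and p: "p \<noteq> 0" "\<And>i. coeff p i \<in> \<rat>" "poly p \<alpha> = 0"
  shows "N \<le> degree p"
proof -
  let ?P = "\<lambda>g. (\<forall>i. coeff g i \<in> \<rat>) \<and> poly g \<alpha> = 0"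
  obtain g0 where g0: "g0 \<noteq> 0" "?P g0" and min: "\<And>q. q \<noteq> 0 \<Longrightarrow> ?P q \<Longrightarrow> degree g0 \<le> degree q"
    using ex_has_least_nat[of "\<lambda>g. g \<noteq> 0 \<and> ?P g" p degree] p by blast
  \<comment> \<open>The minimal polynomial of \<open>\<alpha>\<close> over \<open>\<rat>\<close>.\<close>
  define g where "g = smult (inverse (lead_coeff g0)) g0"
  have g: "g \<noteq> 0" "?P g" "lead_coeff g = 1" "degree g = degree g0"
    using g0 by (auto simp: g_def intro!: Rats_mult Rats_inverse)
  have dvd: "g dvd f" if "?P f" for f
    using that
  proof (induction "degree f" arbitrary: f rule: less_induct)
    case less
    show ?case
    proof (cases "f = 0")
      case False
      define c where "c = Polynomial.monom (lead_coeff f) (degree f - degree g)"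
      have le: "degree g \<le> degree f" using min[OF False] less.prems g(4) by simp
      have deg: "degree (c * g) = degree f"
        using False g(1) le by (simp add: c_def degree_mult_eq degree_monom_eq)
      have P: "?P (f - c * g)"
        using less.prems g(2)
        by (auto simp: c_def coeff_monom_mult intro!: Rats_diff Rats_mult)
      have "g dvd f - c * g"
      proof (cases "f - c * g = 0")
        case nz: False
        have "lead_coeff (c * g) = lead_coeff f"
          using g(3) unfolding lead_coeff_mult c_def by (simp add: degree_monom_eq False)
        hence "coeff (f - c * g) (degree f) = 0" using deg by simp
        moreover have "degree (f - c * g) \<le> degree f"
          using deg by (intro degree_diff_le) auto
        ultimately have "degree (f - c * g) < degree f"
          using nz by (metis le_neq_implies_less leading_coeff_0_iff)
        thus ?thesis using less.hyps P by blast
      qed simp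
      hence "g dvd (f - c * g) + c * g" by (intro dvd_add) auto
      thus ?thesis by simp
    qed simp
  qed
  have "g dvd Polynomial.monom 1 N - [:2:]"
    using N(2) by (intro dvd) (auto simp: poly_monom coeff_pCons intro!: Rats_diff split: nat.splits)
  then obtain q where q: "Polynomial.monom 1 N - [:2:] = g * q" by (rule dvdE)
  have root: "norm x = root N 2" if "poly g x = 0" for x
  proof -
    have "poly (Polynomial.monom 1 N - [:2:]) x = 0" unfolding q using that by simp
    hence "x ^ N = 2" by (simp add: poly_monom)
    hence "norm x ^ N = 2" by (simp flip: norm_power)
    thus ?thesis using N(1) by (metis norm_ge_zero real_root_power_cancel)
  qed
  obtain A where A: "size A = degree g" "g = (\<Prod>x\<in>#A. [:-x, 1:])"
    using alg_closed_imp_factorization[OF g(1)] g(3) by auto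
  have "norm x = root N 2" if "x \<in># A" for x
    using that A(2) by (intro root) (auto simp: poly_prod_mset prod_mset_zero_iff)
  moreover have "coeff g 0 = (\<Prod>x\<in>#A. - x)"
    by (simp add: A(2) poly_prod_mset image_mset.compositionality o_def flip: poly_0_coeff_0)
  moreover have "(\<And>x. x \<in># B \<Longrightarrow> norm x = root N 2) \<Longrightarrow>
      norm (\<Prod>x\<in>#B. - x) = root N 2 ^ size B" for B :: "complex multiset"
    by (induction B) (simp_all add: norm_mult)
  ultimately have norm_g0: "norm (coeff g 0) = root N 2 ^ degree g"
    unfolding A(1)[symmetric] by metis
  obtain r where r: "coeff g 0 = of_rat r"
    using g(2) by (auto elim: Rats_cases)
  have "norm (coeff g 0) = of_rat \<bar>r\<bar>"
    unfolding r by (cases r) (simp add: of_rat_rat norm_divide flip: abs_of_rat)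
  hence "of_rat (\<bar>r\<bar> ^ N) = (root N 2 ^ degree g) ^ N"
    using norm_g0 by (simp add: of_rat_power)
  also have "\<dots> = (root N 2 ^ N) ^ degree g"
    by (simp add: mult.commute flip: power_mult)
  also have "\<dots> = of_rat (2 ^ degree g)"
    using N(1) by (simp add: of_rat_power)
  finally have "\<bar>r\<bar> ^ N = 2 ^ degree g" by (simp only: of_rat_eq_iff)
  hence "N dvd degree g"
    using N(1) by (intro rational_power_eq_2_power) auto
  moreover have "degree g \<noteq> 0"
  proof
    assume "degree g = 0"
    with g(3) have "g = 1" by (metis degree_0_id one_pCons of_nat_0 degree_eq_zeroE lead_coeff_pCons(2) pCons_0_0 zero_neq_one)
    with g(2) show False by simp
  qed
  ultimately have "N \<le> degree g" by (auto dest: dvd_imp_le)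
  also have "\<dots> \<le> degree p" using min[OF p(1)] p g(4) by simp
  finally show ?thesis .
qed

section \<open>Linear dependence\<close>

text \<open>
  Linear dependence of a family, which unlike that of a set of vectors admits repetitions such as
  coinciding powers of a root of unity.
\<close>

lemma (in vector_space) dependent_family:
  assumes B: "finite B" "\<And>k. x k \<in> span B"
  obtains c where "\<exists>k\<le>card B. c k \<noteq> 0" "(\<Sum>k\<le>card B. scale (c k) (x k)) = 0"
proof (cases "inj_on x {..card B}")
  case True
  have "dependent (x ` {..card B})"
  proof (rule ccontr)
    assume "independent (x ` {..card B})"
    moreover have "x ` {..card B} \<subseteq> span B" using B(2) by (rule image_subsetI)
    ultimately have "card (x ` {..card B}) \<le> card B"
      using independent_span_bound[OF B(1)] by simp
    thus False using card_image[OF True] by simp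
  qed
  then obtain u where u: "\<exists>v\<in>x ` {..card B}. u v \<noteq> 0" "(\<Sum>v\<in>x ` {..card B}. scale (u v) v) = 0"
    using dependent_finite[of "x ` {..card B}"] by auto
  from u(1) have "\<exists>k\<le>card B. u (x k) \<noteq> 0" by auto
  moreover have "(\<Sum>k\<le>card B. scale (u (x k)) (x k)) = 0"
    using u(2) by (simp add: sum.reindex[OF True])
  ultimately show ?thesis by (rule that)
next
  case False
  then obtain i j where ij: "i \<le> card B" "j \<le> card B" "i \<noteq> j" "x i = x j"
    by (auto simp: inj_on_def)
  define c :: "nat \<Rightarrow> 'a" where "c = (\<lambda>k. (if k = i then 1 else 0) - (if k = j then 1 else 0))"
  have "(\<Sum>k\<le>card B. scale (c k) (x k)) =
      (\<Sum>k\<le>card B. scale (if k = i then 1 else 0) (x k)) -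
      (\<Sum>k\<le>card B. scale (if k = j then 1 else 0) (x k))"
    by (simp add: c_def scale_left_diff_distrib sum_subtractf)
  also have "\<dots> = 0"
    using ij by (simp add: if_distrib[of "\<lambda>a. scale a _"] sum.delta cong: if_cong)
  finally have "(\<Sum>k\<le>card B. scale (c k) (x k)) = 0" .
  moreover have "c i \<noteq> 0" using ij(3) by (simp add: c_def)
  ultimately show ?thesis using that ij(1) by blast
qed

text \<open>
  When the coefficients are scalars from a field, this form of a polynomial relation of \<open>y\<close>
  shows that \<open>y\<close> is a unit wherever it is not a zero divisor.
\<close>

lemma factor_lowest_term:
  fixes y :: "'a :: comm_ring_1"
  assumes "\<exists>k\<le>m. u k \<noteq> 0"
  obtains j where "j \<le> m" "u j \<noteq> 0"
    "(\<Sum>k\<le>m. u k * y ^ k) = y ^ j * (u j + y * (\<Sum>k<m - j. u (Suc j + k) * y ^ k))"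
proof -
  define j where "j = (LEAST k. k \<le> m \<and> u k \<noteq> 0)"
  have j: "j \<le> m" "u j \<noteq> 0"
    using LeastI_ex[OF assms[unfolded Bex_def atMost_iff]] assms
    by (metis (mono_tags, lifting) LeastI j_def)+
  have zero: "u k = 0" if "k < j" for k
    using not_less_Least[OF that[unfolded j_def]] that j(1) by auto
  have "(\<Sum>k\<le>m. u k * y ^ k) = (\<Sum>k\<in>{j..m}. u k * y ^ k)"
    by (rule sum.mono_neutral_right) (auto simp: not_le zero)
  also have "\<dots> = (\<Sum>k\<le>m - j. u (j + k) * y ^ (j + k))"
    using j(1) by (intro sum.reindex_bij_witness[of _ "\<lambda>k. j + k" "\<lambda>k. k - j"]) auto
  also have "\<dots> = u j * y ^ j + (\<Sum>k<m - j. u (Suc j + k) * y ^ (Suc j + k))"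
    by (subst sum.atMost_shift) simp
  also have "\<dots> = y ^ j * (u j + y * (\<Sum>k<m - j. u (Suc j + k) * y ^ k))"
    by (simp add: algebra_simps sum_distrib_left power_add)
  finally show ?thesis using that j by blast
qed

interpretation rat_cx: vector_space "\<lambda>(q :: rat) (z :: complex). of_rat q * z"
  by unfold_locales (simp_all add: algebra_simps of_rat_add of_rat_mult)

interpretation rat_poly: vector_space "\<lambda>(q :: rat) (p :: complex poly). smult (of_rat q) p"
  by unfold_locales (simp_all add: algebra_simps of_rat_add of_rat_mult smult_add_left smult_add_right)

section \<open>The graded ring\<close>

locale sumset_domain =
  fixes N :: nat and S :: "nat set" and t :: nat
  assumes N_pos: "0 < N" and S_subset: "S \<subseteq> {..<N}" and zero_in_S: "0 \<in> S"
    and sumset_top: "sumset N S t = {..<N}"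
begin

definition \<alpha> :: complex where "\<alpha> = complex_of_real (root N 2)"

definition V :: "nat \<Rightarrow> complex set" where
  "V n = rat_cx.span ((\<lambda>k. \<alpha> ^ k) ` sumset N S n)"

text \<open>
  As a subring of \<open>L[X]\<close>, where \<open>L = V t\<close>, the ring is a domain for free.
\<close>

definition G :: "ambient ring" where
  "G = \<lparr>carrier = {p. \<forall>n. coeff p n \<in> V n}, mult = (*), one = 1, zero = 0, add = (+)\<rparr>"

definition G_comp :: "nat \<Rightarrow> ambient set" where
  "G_comp n = (\<lambda>c. Polynomial.monom c n) ` V n"

lemma alpha_power_N: "\<alpha> ^ N = 2"
  using N_pos by (simp add: \<alpha>_def flip: of_real_power)

lemma inj_alpha_power: "inj (\<lambda>k. \<alpha> ^ k)"
proof (rule injI)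
  fix i j assume "\<alpha> ^ i = \<alpha> ^ j"
  hence "root N 2 ^ i = root N 2 ^ j"
    unfolding \<alpha>_def by (simp only: of_real_power[symmetric] of_real_eq_iff)
  moreover have "1 < root N 2" using N_pos by simp
  ultimately show "i = j" by (metis power_inject_exp)
qed

lemma alpha_independent: "rat_cx.independent ((\<lambda>k. \<alpha> ^ k) ` {..<N})"
proof (rule rat_cx.independent_if_scalars_zero)
  fix f x assume sum: "(\<Sum>z\<in>(\<lambda>k. \<alpha> ^ k) ` {..<N}. of_rat (f z) * z) = 0"
    and x: "x \<in> (\<lambda>k. \<alpha> ^ k) ` {..<N}"
  define p where "p = (\<Sum>k<N. Polynomial.monom (of_rat (f (\<alpha> ^ k)) :: complex) k)"
  have coeff_p: "coeff p i = (if i < N then of_rat (f (\<alpha> ^ i)) else 0)" for i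
    by (simp add: p_def coeff_sum)
  have "poly p \<alpha> = 0"
    using sum by (simp add: p_def poly_sum poly_monom sum.reindex inj_on_subset[OF inj_alpha_power])
  moreover have "degree p < N"
    using N_pos by (intro degree_lessI) (auto simp: coeff_p)
  ultimately have "p = 0"
    using degree_of_root_of_2[OF N_pos alpha_power_N, of p] by (force simp: coeff_p)
  hence "coeff p k = 0" for k by simp
  moreover from x obtain k where "k < N" "x = \<alpha> ^ k" by blast
  ultimately show "f x = 0" using coeff_p[of k] by simp
qed simp

lemma V_0: "V 0 = range of_rat"
  by (auto simp: V_def rat_cx.span_singleton)

lemma V_closed [simp, intro]:
  "0 \<in> V n" "x \<in> V n \<Longrightarrow> y \<in> V n \<Longrightarrow> x + y \<in> V n" "x \<in> V n \<Longrightarrow> - x \<in> V n"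
  "x \<in> V n \<Longrightarrow> y \<in> V n \<Longrightarrow> x - y \<in> V n" "x \<in> V n \<Longrightarrow> of_rat q * x \<in> V n"
  by (simp_all add: V_def rat_cx.span_zero rat_cx.span_add rat_cx.span_neg rat_cx.span_diff
      rat_cx.span_scale)

lemma V_sum: "(\<And>x. x \<in> A \<Longrightarrow> f x \<in> V n) \<Longrightarrow> sum f A \<in> V n"
  unfolding V_def by (rule rat_cx.span_sum)

lemma V_mono: "m \<le> n \<Longrightarrow> V m \<subseteq> V n"
  unfolding V_def
  by (intro rat_cx.span_mono image_mono sumset_mono[OF N_pos zero_in_S])

lemma V_subset_top: "V n \<subseteq> V t"
  unfolding V_def sumset_top
  by (intro rat_cx.span_mono image_mono) (auto dest: sumset_less[OF N_pos])

lemma V_top: "t \<le> n \<Longrightarrow> V n = V t"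
  using V_mono[of t n] V_subset_top[of n] by blast

lemma one_in_V [simp, intro]: "1 \<in> V n"
  using V_mono[of 0 n] by (auto simp: V_0 intro!: range_eqI[of _ _ 1])

lemma alpha_power_mod: "\<alpha> ^ k = of_rat (2 ^ (k div N)) * \<alpha> ^ (k mod N)"
proof -
  have "\<alpha> ^ k = \<alpha> ^ (N * (k div N) + k mod N)" by simp
  also have "\<dots> = (\<alpha> ^ N) ^ (k div N) * \<alpha> ^ (k mod N)"
    by (simp only: power_add power_mult)
  finally show ?thesis by (simp add: alpha_power_N of_rat_power)
qed

lemma alpha_power_in_V: "k \<in> sumset N S n \<Longrightarrow> \<alpha> ^ k \<in> V n"
  unfolding V_def by (intro rat_cx.span_base imageI)

lemma V_induct [consumes 1, case_names zero step]:
  assumes "z \<in> V n" "P 0"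
    and "\<And>q k y. k \<in> sumset N S n \<Longrightarrow> y \<in> V n \<Longrightarrow> P y \<Longrightarrow> P (of_rat q * \<alpha> ^ k + y)"
  shows "P z"
proof -
  have "z \<in> V n \<and> P z"
    using assms(1) unfolding V_def
  proof (induction rule: rat_cx.span_induct_alt)
    case base
    show ?case using assms(2) V_closed(1)[of n] by (simp add: V_def)
  next
    case (step c x y)
    then obtain k where k: "k \<in> sumset N S n" "x = \<alpha> ^ k" by blast
    have y: "y \<in> V n" "P y" using step by (simp_all add: V_def)
    have "of_rat c * x + y \<in> V n"
      using k y(1) by (auto intro!: V_closed alpha_power_in_V)
    with assms(3)[OF k(1) y] show ?case by (simp add: k(2) V_def)
  qed
  thus ?thesis ..
qed

lemma V_mult: "x \<in> V m \<Longrightarrow> y \<in> V n \<Longrightarrow> x * y \<in> V (m + n)"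
proof (induction x rule: V_induct)
  case (step q a x)
  from step(4) have "\<alpha> ^ a * y \<in> V (m + n)"
  proof (induction y rule: V_induct)
    case (step r b y)
    have "\<alpha> ^ a * \<alpha> ^ b = of_rat (2 ^ ((a + b) div N)) * \<alpha> ^ ((a + b) mod N)"
      using alpha_power_mod[of "a + b"] by (simp add: power_add)
    also have "\<dots> \<in> V (m + n)"
      by (intro V_closed alpha_power_in_V sumset_add[OF N_pos]; fact)
    finally have "of_rat r * (\<alpha> ^ a * \<alpha> ^ b) + \<alpha> ^ a * y \<in> V (m + n)"
      using step.IH by (intro V_closed)
    thus ?case by (simp add: algebra_simps)
  qed simp
  with step have "of_rat q * (\<alpha> ^ a * y) + x * y \<in> V (m + n)"
    by (intro V_closed) auto
  thus ?case by (simp add: algebra_simps)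
qed simp

lemma V_top_mult: "x \<in> V t \<Longrightarrow> y \<in> V t \<Longrightarrow> x * y \<in> V t"
  using V_mult[of x t y t] V_top[of "t + t"] by simp

text \<open>
  A finite-dimensional domain over a field is a field: a relation between the powers of \<open>x\<close>
  yields an inverse.
\<close>

lemma V_top_inverse:
  assumes "x \<in> V t"
  shows "inverse x \<in> V t"
proof (cases "x = 0")
  case False
  have pow: "x ^ k \<in> V t" for k
    by (induction k) (auto intro: V_top_mult assms)
  have fin: "finite ((\<lambda>k. \<alpha> ^ k) ` sumset N S t)"
    using finite_sumset[OF N_pos] by simp
  define m where "m = card ((\<lambda>k. \<alpha> ^ k) ` sumset N S t)"
  obtain c :: "nat \<Rightarrow> rat" where c: "\<exists>k\<le>m. c k \<noteq> 0" "(\<Sum>k\<le>m. of_rat (c k) * x ^ k) = 0"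
    unfolding m_def by (rule rat_cx.dependent_family[OF fin pow[unfolded V_def]])
  from c(1) have "\<exists>k\<le>m. (of_rat (c k) :: complex) \<noteq> 0" by simp
  then obtain j where j: "(of_rat (c j) :: complex) \<noteq> 0"
    "(\<Sum>k\<le>m. of_rat (c k) * x ^ k) =
      x ^ j * (of_rat (c j) + x * (\<Sum>k<m - j. of_rat (c (Suc j + k)) * x ^ k))"
    by (rule factor_lowest_term)
  define z where "z = (\<Sum>k<m - j. of_rat (c (Suc j + k)) * x ^ k)"
  have z: "z \<in> V t" unfolding z_def by (intro V_sum V_closed pow)
  have "of_rat (c j) + x * z = 0"
    using j(2) c(2) False by (simp add: z_def)
  hence "inverse x = of_rat (- 1 / c j) * z"
    using False j(1) by (simp add: field_simps of_rat_divide of_rat_minus eq_neg_iff_add_eq_0)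
  thus ?thesis using z by (simp only: V_closed)
qed simp

lemma carrier_iff: "p \<in> carrier G \<longleftrightarrow> (\<forall>n. coeff p n \<in> V n)"
  by (simp add: G_def)

lemma G_simps [simp]:
  "mult G = (*)" "one G = 1" "zero G = 0" "add G = (+)"
  by (simp_all add: G_def)

lemma coeff_in_V: "p \<in> carrier G \<Longrightarrow> coeff p n \<in> V n"
  by (simp add: carrier_iff)

lemma carrier_closed [simp, intro]:
  "0 \<in> carrier G" "1 \<in> carrier G"
  "p \<in> carrier G \<Longrightarrow> q \<in> carrier G \<Longrightarrow> p + q \<in> carrier G"
  "p \<in> carrier G \<Longrightarrow> - p \<in> carrier G"
  "p \<in> carrier G \<Longrightarrow> q \<in> carrier G \<Longrightarrow> p - q \<in> carrier G"
  "p \<in> carrier G \<Longrightarrow> smult (of_rat r) p \<in> carrier G"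
  "[:of_rat r:] \<in> carrier G"
  by (auto simp: carrier_iff coeff_1 coeff_pCons V_0 split: if_splits nat.splits)

lemma carrier_mult [simp, intro]:
  assumes "p \<in> carrier G" "q \<in> carrier G"
  shows "p * q \<in> carrier G"
  unfolding carrier_iff coeff_mult
proof (intro allI V_sum)
  fix n i :: nat assume "i \<in> {..n}"
  with V_mult[OF coeff_in_V[OF assms(1), of i] coeff_in_V[OF assms(2), of "n - i"]]
  show "coeff p i * coeff q (n - i) \<in> V n" by simp
qed

lemma carrier_sum: "(\<And>x. x \<in> A \<Longrightarrow> f x \<in> carrier G) \<Longrightarrow> sum f A \<in> carrier G"
  by (induction A rule: infinite_finite_induct) auto

lemma carrier_power [simp]: "p \<in> carrier G \<Longrightarrow> p ^ k \<in> carrier G"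
  by (induction k) auto

lemma carrier_monom [simp]: "Polynomial.monom c n \<in> carrier G \<longleftrightarrow> c \<in> V n"
  by (auto simp: carrier_iff split: if_splits)

lemma cring_G: "cring G"
proof (rule cringI)
  show "abelian_group G"
    by (rule abelian_groupI) (auto intro: bexI[of _ "- _"])
  show "comm_monoid G"
    by (rule comm_monoidI) (auto simp: mult.assoc mult.commute)
qed (auto simp: algebra_simps)

sublocale domain G
proof (intro domain.intro domain_axioms.intro)
  show "cring G" by (rule cring_G)
qed auto

lemma a_inv_G [simp]: "p \<in> carrier G \<Longrightarrow> a_inv G p = - p"
  by (rule minus_equality) auto

lemma finsum_G: "finite F \<Longrightarrow> f \<in> F \<rightarrow> carrier G \<Longrightarrow> finsum G f F = sum f F"
  by (induction F rule: finite_induct) (simp_all add: Pi_def)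

subsection \<open>The grading\<close>

lemma G_comp_iff: "p \<in> G_comp n \<longleftrightarrow> (\<exists>c\<in>V n. p = Polynomial.monom c n)"
  by (auto simp: G_comp_def)

lemma G_comp_0: "G_comp 0 = range (\<lambda>q. [:of_rat q:])"
  by (auto simp: G_comp_def V_0 monom_0)

lemma G_comp_subset: "G_comp n \<subseteq> carrier G"
  by (auto simp: G_comp_iff)

lemma G_comp_subgroup: "additive_subgroup (G_comp n) G"
proof (rule additive_subgroupI, rule add.subgroupI)
  show "G_comp n \<noteq> {}" by (auto simp: G_comp_def intro: V_closed(1))
  show "a_inv G p \<in> G_comp n" if "p \<in> G_comp n" for p
  proof -
    from that obtain c where c: "c \<in> V n" "p = Polynomial.monom c n" by (auto simp: G_comp_iff)
    have "a_inv G p = Polynomial.monom (- c) n" using c by (simp add: minus_monom)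
    with c(1) show ?thesis by (auto simp: G_comp_iff)
  qed
  show "p \<oplus>\<^bsub>G\<^esub> q \<in> G_comp n" if "p \<in> G_comp n" "q \<in> G_comp n" for p q
    using that by (auto simp: G_comp_iff add_monom)
qed (rule G_comp_subset)

lemma subfield_G_comp_0: "subfield (G_comp 0) G"
proof (rule subfieldI)
  have "subring (G_comp 0) G"
  proof (rule subringI)
    show "\<one>\<^bsub>G\<^esub> \<in> G_comp 0" by (auto simp: G_comp_0 one_pCons intro: range_eqI[of _ _ 1])
    show "a_inv G h \<in> G_comp 0" if "h \<in> G_comp 0" for h
      using that by (auto simp: G_comp_0 simp flip: of_rat_minus)
    show "h1 \<otimes>\<^bsub>G\<^esub> h2 \<in> G_comp 0" "h1 \<oplus>\<^bsub>G\<^esub> h2 \<in> G_comp 0"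
      if "h1 \<in> G_comp 0" "h2 \<in> G_comp 0" for h1 h2
      using that by (auto simp: G_comp_0 simp flip: of_rat_mult of_rat_add)
  qed (rule G_comp_subset)
  thus "subcring (G_comp 0) G" by (rule subcringI')
  have "\<exists>q'. of_rat q * of_rat q' = (1 :: complex)" if "q \<noteq> 0" for q
    using that by (intro exI[of _ "inverse q"]) (simp add: of_rat_inverse)
  thus "Units (G\<lparr>carrier := G_comp 0\<rparr>) = G_comp 0 - {\<zero>\<^bsub>G\<^esub>}"
    by (fastforce simp: Units_def G_comp_0 one_pCons mult.commute)
qed

lemma direct_sum_G:
  assumes p: "p \<in> carrier G"
  shows "\<exists>!f. (\<forall>n. f n \<in> G_comp n) \<and> finite {n. f n \<noteq> \<zero>\<^bsub>G\<^esub>} \<and>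
    p = finsum G f {n. f n \<noteq> \<zero>\<^bsub>G\<^esub>}"
proof (rule ex1I[of _ "\<lambda>n. Polynomial.monom (coeff p n) n"])
  have fin: "finite {n. coeff p n \<noteq> 0}"
    using MOST_coeff_eq_0[of p] by (simp add: eventually_cofinite)
  have "p = (\<Sum>n | coeff p n \<noteq> 0. Polynomial.monom (coeff p n) n)"
  proof -
    have "p = (\<Sum>n\<le>degree p. Polynomial.monom (coeff p n) n)"
      by (simp add: poly_as_sum_of_monoms)
    also have "\<dots> = (\<Sum>n | coeff p n \<noteq> 0. Polynomial.monom (coeff p n) n)"
      by (rule sum.mono_neutral_right) (auto intro: le_degree)
    finally show ?thesis .
  qed
  thus "(\<forall>n. Polynomial.monom (coeff p n) n \<in> G_comp n) \<and>
      finite {n. Polynomial.monom (coeff p n) n \<noteq> \<zero>\<^bsub>G\<^esub>} \<and>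
      p = finsum G (\<lambda>n. Polynomial.monom (coeff p n) n) {n. Polynomial.monom (coeff p n) n \<noteq> \<zero>\<^bsub>G\<^esub>}"
    using fin coeff_in_V[OF p] by (auto simp: G_comp_iff finsum_G Pi_def)
  fix f assume f: "(\<forall>n. f n \<in> G_comp n) \<and> finite {n. f n \<noteq> \<zero>\<^bsub>G\<^esub>} \<and>
    p = finsum G f {n. f n \<noteq> \<zero>\<^bsub>G\<^esub>}"
  have "f \<in> {n. f n \<noteq> 0} \<rightarrow> carrier G"
    using f G_comp_subset by blast
  with f have p_sum: "p = (\<Sum>n | f n \<noteq> 0. f n)"
    by (simp add: finsum_G)
  from f have "\<forall>n. \<exists>c. f n = Polynomial.monom c n" by (auto simp: G_comp_iff)
  then obtain c where c: "\<And>n. f n = Polynomial.monom (c n) n" by metis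
  have "coeff p n = c n" for n
  proof -
    have "coeff p n = (\<Sum>k | f k \<noteq> 0. if k = n then c n else 0)"
      unfolding p_sum coeff_sum by (intro sum.cong) (auto simp: c)
    also have "\<dots> = c n" using f by (auto simp: sum.delta' c)
    finally show ?thesis .
  qed
  thus "f = (\<lambda>n. Polynomial.monom (coeff p n) n)" by (auto simp: c)
qed

text \<open>
  A residue in \<open>(n+1)S\<close> is \<open>a + b\<close> with \<open>a \<in> S\<close> and \<open>b \<in> nS\<close>, and reducing \<open>a + b\<close> modulo
  \<open>N\<close> changes \<open>\<alpha>\<^sup>a \<alpha>\<^sup>b\<close> only by a power of 2, which is a scalar of degree zero.
\<close>

lemma monom_in_generate_ring:
  assumes "c \<in> V n"
  shows "Polynomial.monom c n \<in> generate_ring G (G_comp 0 \<union> G_comp 1)"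
  using assms
proof (induction n arbitrary: c)
  case 0
  thus ?case by (intro generate_ring.incl) (auto simp: G_comp_iff)
next
  case (Suc n)
  let ?gen = "generate_ring G (G_comp 0 \<union> G_comp 1)"
  from Suc.prems show ?case
  proof (induction c rule: V_induct)
    case zero
    show ?case using zero_in_generate by simp
  next
    case (step q k y)
    from step(1) obtain a b where ab: "a \<in> S" "b \<in> sumset N S n" "k = (a + b) mod N"
      by auto
    define r :: rat where "r = q / 2 ^ ((a + b) div N)"
    have "of_rat q * \<alpha> ^ k = of_rat r * (\<alpha> ^ a * \<alpha> ^ b)"
      unfolding power_add[symmetric] alpha_power_mod[of "a + b"] ab(3)
      by (simp add: r_def of_rat_divide of_rat_power)
    hence "Polynomial.monom (of_rat q * \<alpha> ^ k) (Suc n) =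
        [:of_rat r:] * (Polynomial.monom (\<alpha> ^ a) 1 * Polynomial.monom (\<alpha> ^ b) n)"
      by (simp add: mult_monom smult_monom)
    moreover have "[:of_rat r:] \<in> ?gen"
      by (intro generate_ring.incl) (auto simp: G_comp_0)
    moreover have "Polynomial.monom (\<alpha> ^ a) 1 \<in> ?gen"
    proof -
      have "a < N" using ab(1) S_subset by auto
      hence "a \<in> sumset N S 1"
        using sumset_SucI[OF ab(1), of 0 N 0] by simp
      hence "Polynomial.monom (\<alpha> ^ a) 1 \<in> G_comp 1"
        unfolding G_comp_def by (intro imageI alpha_power_in_V)
      thus ?thesis by (intro generate_ring.incl UnI2)
    qed
    moreover have "Polynomial.monom (\<alpha> ^ b) n \<in> ?gen"
      using ab(2) by (intro Suc.IH alpha_power_in_V)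
    ultimately have "Polynomial.monom (of_rat q * \<alpha> ^ k) (Suc n) \<in> ?gen"
      by (metis generate_ring.eng_mult G_simps(1))
    with step(3) show ?case
      using generate_ring.eng_add[of _ G "G_comp 0 \<union> G_comp 1"] by (simp flip: add_monom)
  qed
qed

lemma generate_ring_G: "generate_ring G (G_comp 0 \<union> G_comp 1) = carrier G"
proof (intro equalityI subsetI)
  show "p \<in> carrier G" if "p \<in> generate_ring G (G_comp 0 \<union> G_comp 1)" for p
    using that generate_ring_in_carrier[of "G_comp 0 \<union> G_comp 1"] G_comp_subset by blast
next
  fix p assume p: "p \<in> carrier G"
  let ?gen = "generate_ring G (G_comp 0 \<union> G_comp 1)"
  have "(\<Sum>n\<in>F. Polynomial.monom (coeff p n) n) \<in> ?gen" for F
  proof (induction F rule: infinite_finite_induct)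
    case (insert n F)
    thus ?case
      using monom_in_generate_ring[OF coeff_in_V[OF p]]
        generate_ring.eng_add[of _ G "G_comp 0 \<union> G_comp 1"] by simp
  qed (use zero_in_generate in simp_all)
  from this[of "{..degree p}"] show "p \<in> ?gen"
    by (simp add: poly_as_sum_of_monoms)
qed

lemma Span_monomials:
  assumes "set ks \<subseteq> sumset N S n"
  shows "Span (G_comp 0) (map (\<lambda>k. Polynomial.monom (\<alpha> ^ k) n) ks) =
    (\<lambda>c. Polynomial.monom c n) ` rat_cx.span ((\<lambda>k. \<alpha> ^ k) ` set ks)"
  using assms
proof (induction ks)
  case (Cons k ks)
  let ?m = "\<lambda>c. Polynomial.monom c n"
  have "Span (G_comp 0) (map (\<lambda>k. ?m (\<alpha> ^ k)) (k # ks)) =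
      line_extension (G_comp 0) (?m (\<alpha> ^ k)) (?m ` rat_cx.span ((\<lambda>k. \<alpha> ^ k) ` set ks))"
    using Cons by simp
  also have "\<dots> = {?m (of_rat q * \<alpha> ^ k + v) | q v. v \<in> rat_cx.span ((\<lambda>k. \<alpha> ^ k) ` set ks)}"
    by (auto simp: line_extension_mem_iff G_comp_0 smult_monom add_monom) blast+
  also have "\<dots> = ?m ` rat_cx.span (insert (\<alpha> ^ k) ((\<lambda>k. \<alpha> ^ k) ` set ks))"
    unfolding rat_cx.span_insert
  proof (intro equalityI subsetI)
    fix p assume "p \<in> {?m (of_rat q * \<alpha> ^ k + v) | q v. v \<in> rat_cx.span ((\<lambda>k. \<alpha> ^ k) ` set ks)}"
    then obtain q v where qv: "p = ?m (of_rat q * \<alpha> ^ k + v)" "v \<in> rat_cx.span ((\<lambda>k. \<alpha> ^ k) ` set ks)"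
      by blast
    have "of_rat q * \<alpha> ^ k + v \<in> {x. \<exists>r. x - of_rat r * \<alpha> ^ k \<in> rat_cx.span ((\<lambda>k. \<alpha> ^ k) ` set ks)}"
      using qv(2) by (intro CollectI exI[of _ q]) simp
    thus "p \<in> ?m ` {x. \<exists>r. x - of_rat r * \<alpha> ^ k \<in> rat_cx.span ((\<lambda>k. \<alpha> ^ k) ` set ks)}"
      unfolding qv(1) by (rule imageI)
  next
    fix p assume "p \<in> ?m ` {x. \<exists>r. x - of_rat r * \<alpha> ^ k \<in> rat_cx.span ((\<lambda>k. \<alpha> ^ k) ` set ks)}"
    then obtain x r where "p = ?m (of_rat r * \<alpha> ^ k + (x - of_rat r * \<alpha> ^ k))"
      "x - of_rat r * \<alpha> ^ k \<in> rat_cx.span ((\<lambda>k. \<alpha> ^ k) ` set ks)" by auto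
    thus "p \<in> {?m (of_rat q * \<alpha> ^ k + v) | q v. v \<in> rat_cx.span ((\<lambda>k. \<alpha> ^ k) ` set ks)}"
      by blast
  qed
  finally show ?case by simp
qed (simp add: monom_0)

lemma independent_monomials:
  assumes "set ks \<subseteq> sumset N S n" "distinct ks"
  shows "independent (G_comp 0) (map (\<lambda>k. Polynomial.monom (\<alpha> ^ k) n) ks)"
  using assms
proof (induction ks)
  case (Cons k ks)
  have sub: "insert k (set ks) \<subseteq> {..<N}"
    using Cons.prems(1) sumset_less[OF N_pos] by auto
  have "\<alpha> ^ k \<notin> rat_cx.span ((\<lambda>k. \<alpha> ^ k) ` set ks)"
  proof -
    have "(\<lambda>k. \<alpha> ^ k) ` set ks \<subseteq> (\<lambda>k. \<alpha> ^ k) ` {..<N} - {\<alpha> ^ k}"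
      using Cons.prems(2) sub inj_alpha_power by (auto dest: injD)
    hence "rat_cx.span ((\<lambda>k. \<alpha> ^ k) ` set ks) \<subseteq> rat_cx.span ((\<lambda>k. \<alpha> ^ k) ` {..<N} - {\<alpha> ^ k})"
      by (rule rat_cx.span_mono)
    moreover have "\<alpha> ^ k \<notin> rat_cx.span ((\<lambda>k. \<alpha> ^ k) ` {..<N} - {\<alpha> ^ k})"
    proof
      assume "\<alpha> ^ k \<in> rat_cx.span ((\<lambda>k. \<alpha> ^ k) ` {..<N} - {\<alpha> ^ k})"
      moreover have "\<alpha> ^ k \<in> (\<lambda>k. \<alpha> ^ k) ` {..<N}" using sub by (intro imageI) simp
      ultimately have "rat_cx.dependent ((\<lambda>k. \<alpha> ^ k) ` {..<N})"
        unfolding rat_cx.dependent_def by (rule rev_bexI[rotated])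
      thus False using alpha_independent by contradiction
    qed
    ultimately show ?thesis by (rule contra_subsetD)
  qed
  hence "Polynomial.monom (\<alpha> ^ k) n \<notin> Span (G_comp 0) (map (\<lambda>k. Polynomial.monom (\<alpha> ^ k) n) ks)"
    using Cons.prems(1) by (subst Span_monomials) auto
  moreover have "Polynomial.monom (\<alpha> ^ k) n \<in> carrier G"
    using Cons.prems(1) by (simp add: alpha_power_in_V)
  ultimately show ?case using Cons by (simp del: Span.simps add: li_Cons)
qed simp

lemma dimension_G_comp: "dimension (card (sumset N S n)) (G_comp 0) (G_comp n)"
proof -
  from finite_distinct_list[OF finite_sumset[OF N_pos, of S n]]
  obtain ks where ks: "set ks = sumset N S n" "distinct ks" by auto
  have "Span (G_comp 0) (map (\<lambda>k. Polynomial.monom (\<alpha> ^ k) n) ks) = G_comp n"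
    using ks(1) by (subst Span_monomials) (simp_all add: G_comp_def V_def)
  moreover have "dimension (length (map (\<lambda>k. Polynomial.monom (\<alpha> ^ k) n) ks)) (G_comp 0)
      (Span (G_comp 0) (map (\<lambda>k. Polynomial.monom (\<alpha> ^ k) n) ks))"
    using ks by (intro dimension_independent independent_monomials) simp_all
  ultimately have "dimension (length ks) (G_comp 0) (G_comp n)"
    by (simp only: length_map)
  thus ?thesis using ks by (metis distinct_card)
qed

lemma hilbert_fun_G: "hilbert_fun G G_comp n = card (sumset N S n)"
  using dimI[OF subfield_G_comp_0 dimension_G_comp] by (simp add: hilbert_fun_def over_def)

subsection \<open>Finiteness modulo a non-zero element\<close>

text \<open>
  Polynomial division, which may go on as long as the quotient of the leading coefficients, an
  element of \<open>L\<close>, belongs to the component of the degree where it is needed.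
\<close>

lemma division:
  assumes f: "f \<in> carrier G" "f \<noteq> 0" and p: "p \<in> carrier G"
  obtains q where "q \<in> carrier G" "degree (p - q * f) \<le> degree f + t"
proof -
  have "\<exists>q\<in>carrier G. degree (p - q * f) \<le> degree f + t"
    using p
  proof (induction "degree p" arbitrary: p rule: less_induct)
    case less
    show ?case
    proof (cases "degree p \<le> degree f + t")
      case True
      thus ?thesis by (intro bexI[of _ 0]) auto
    next
      case False
      define e where "e = degree p - degree f"
      define m where "m = Polynomial.monom (lead_coeff p * inverse (lead_coeff f)) e"
      have "lead_coeff p \<in> V t" "lead_coeff f \<in> V t"
        using coeff_in_V less.prems f(1) V_subset_top by blast+
      hence "lead_coeff p * inverse (lead_coeff f) \<in> V t"
        by (intro V_top_mult V_top_inverse)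
      hence m: "m \<in> carrier G"
        using V_top[of e] False by (simp add: m_def e_def)
      have "p \<noteq> 0" using False by auto
      hence nz: "lead_coeff p * inverse (lead_coeff f) \<noteq> 0" using f(2) by simp
      have deg: "degree (m * f) = degree p"
        using nz f(2) False by (simp add: m_def e_def degree_mult_eq degree_monom_eq)
      have "coeff (m * f) (degree p) = lead_coeff p"
        using f(2) False by (simp add: m_def e_def coeff_monom_mult)
      hence "coeff (p - m * f) (degree p) = 0" by simp
      moreover have "degree (p - m * f) \<le> degree p"
        using deg by (intro degree_diff_le) auto
      ultimately have "degree (p - m * f) < degree p"
        using False by (metis add_leD2 degree_0 le_neq_implies_less leading_coeff_0_iff not_le zero_le)
      moreover have "p - m * f \<in> carrier G" using m f(1) less.prems by auto
      ultimately obtain q where q: "q \<in> carrier G" "degree (p - m * f - q * f) \<le> degree f + t"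
        using less.hyps by blast
      have "p - m * f - q * f = p - (m + q) * f" by (simp add: algebra_simps)
      with q m show ?thesis by (intro bexI[of _ "m + q"]) auto
    qed
  qed
  thus ?thesis using that by blast
qed

definition low_monomials :: "nat \<Rightarrow> complex poly set" where
  "low_monomials d = (\<lambda>(k, n). Polynomial.monom (\<alpha> ^ k) n) ` ({..<N} \<times> {..d})"

lemma finite_low_monomials: "finite (low_monomials d)"
  by (simp add: low_monomials_def)

lemma in_span_low_monomials:
  assumes p: "p \<in> carrier G" "degree p \<le> d"
  shows "p \<in> rat_poly.span (low_monomials d)"
proof -
  have "Polynomial.monom c n \<in> rat_poly.span (low_monomials d)" if "c \<in> V n" "n \<le> d" for c n
    using that(1)
  proof (induction c rule: V_induct)
    case zero
    show ?case by (simp add: rat_poly.span_zero)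
  next
    case (step q k y)
    have "Polynomial.monom (\<alpha> ^ k) n \<in> low_monomials d"
      using sumset_less[OF N_pos step(1)] that(2) by (force simp: low_monomials_def)
    hence "smult (of_rat q) (Polynomial.monom (\<alpha> ^ k) n) + Polynomial.monom y n
        \<in> rat_poly.span (low_monomials d)"
      using step(3) by (intro rat_poly.span_add[OF rat_poly.span_scale[OF rat_poly.span_base]])
    thus ?case by (simp add: smult_monom add_monom)
  qed
  hence "(\<Sum>n\<le>d. Polynomial.monom (coeff p n) n) \<in> rat_poly.span (low_monomials d)"
    using coeff_in_V[OF p(1)] by (intro rat_poly.span_sum) auto
  thus ?thesis using p(2) by (simp add: poly_as_sum_of_monoms')
qed

text \<open>
  The powers of \<open>y\<close> leave remainders modulo \<open>f\<close> in a finite-dimensional space, so some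
  non-trivial rational combination of them is a multiple of \<open>f\<close>.
\<close>

lemma power_relation:
  assumes f: "f \<in> carrier G" "f \<noteq> 0" and y: "y \<in> carrier G"
  obtains j z g where "z \<in> carrier G" "g \<in> carrier G" "y ^ j * (1 + y * z) = f * g"
proof -
  define d where "d = degree f + t"
  have "\<forall>k. \<exists>q. q \<in> carrier G \<and> degree (y ^ k - q * f) \<le> d"
    using division[OF f carrier_power[OF y]] unfolding d_def by metis
  then obtain q where q: "\<And>k. q k \<in> carrier G" "\<And>k. degree (y ^ k - q k * f) \<le> d"
    by metis
  define m where "m = card (low_monomials d)"
  have span: "y ^ k - q k * f \<in> rat_poly.span (low_monomials d)" for k
    using q y f by (intro in_span_low_monomials) auto
  obtain c :: "nat \<Rightarrow> rat" where c: "\<exists>k\<le>m. c k \<noteq> 0"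
    "(\<Sum>k\<le>m. smult (of_rat (c k)) (y ^ k - q k * f)) = 0"
    unfolding m_def by (rule rat_poly.dependent_family[OF finite_low_monomials span])
  define u where "u = (\<lambda>k. [:of_rat (c k):] :: complex poly)"
  define g where "g = (\<Sum>k\<le>m. smult (of_rat (c k)) (q k))"
  have g: "g \<in> carrier G" unfolding g_def by (intro carrier_sum carrier_closed q)
  have "(\<Sum>k\<le>m. u k * y ^ k) - g * f = (\<Sum>k\<le>m. smult (of_rat (c k)) (y ^ k - q k * f))"
    by (simp add: u_def g_def sum_distrib_right sum_subtractf smult_diff_right)
  hence sum: "(\<Sum>k\<le>m. u k * y ^ k) = g * f" using c(2) by simp
  from c(1) have "\<exists>k\<le>m. u k \<noteq> 0" by (simp add: u_def)
  then obtain j where j: "u j \<noteq> 0"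
    "(\<Sum>k\<le>m. u k * y ^ k) = y ^ j * (u j + y * (\<Sum>k<m - j. u (Suc j + k) * y ^ k))"
    by (rule factor_lowest_term)
  define z where "z = (\<Sum>k<m - j. u (Suc j + k) * y ^ k)"
  have z: "z \<in> carrier G"
    unfolding z_def by (intro carrier_sum carrier_mult carrier_power y) (simp add: u_def)
  \<comment> \<open>Scaling that makes the lowest coefficient 1.\<close>
  define s where "s = smult (of_rat (inverse (c j)) :: complex)"
  have s_mult: "s (a * b) = s a * b" "s (a * b) = a * s b" "s (a + b) = s a + s b" for a b
    by (simp_all add: s_def smult_add_right)
  have s_u: "s (u j) = 1"
    using j(1) by (simp add: s_def u_def one_pCons flip: of_rat_mult)
  have "y ^ j * (u j + y * z) = g * f" using sum j(2) by (simp add: z_def)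
  hence "s (y ^ j * (u j + y * z)) = s (g * f)" by simp
  hence "y ^ j * (1 + y * s z) = f * s g"
    by (simp add: s_u s_mult(2)[of "y ^ j"] s_mult(3) s_mult(2)[of y] s_mult(1)[of g] mult.commute[of f])
  moreover have "s z \<in> carrier G" "s g \<in> carrier G"
    using z g by (simp_all add: s_def)
  ultimately show ?thesis using that by blast
qed

subsection \<open>Ideals\<close>

lemma ideal_closed:
  assumes "ideal I G"
  shows "0 \<in> I" "I \<subseteq> carrier G" "\<And>a b. a \<in> I \<Longrightarrow> b \<in> I \<Longrightarrow> a + b \<in> I"
    "\<And>a b. a \<in> I \<Longrightarrow> b \<in> carrier G \<Longrightarrow> a * b \<in> I"
    "\<And>a b. a \<in> I \<Longrightarrow> b \<in> carrier G \<Longrightarrow> b * a \<in> I"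
    "\<And>a q. a \<in> I \<Longrightarrow> smult (of_rat q) a \<in> I"
proof -
  interpret I: ideal I G by fact
  show "0 \<in> I" using I.zero_closed by simp
  show "I \<subseteq> carrier G" by (rule I.a_subset)
  show "a + b \<in> I" if "a \<in> I" "b \<in> I" for a b using I.a_closed[OF that] by simp
  show "a * b \<in> I" if "a \<in> I" "b \<in> carrier G" for a b using I.I_r_closed[OF that] by simp
  show *: "b * a \<in> I" if "a \<in> I" "b \<in> carrier G" for a b using I.I_l_closed[OF that] by simp
  show "smult (of_rat q) a \<in> I" if "a \<in> I" for a q using *[OF that, of "[:of_rat q:]"] by simp
qed

lemma genideal_empty: "genideal G {} = {0}"
proof
  show "genideal G {} \<subseteq> {0}" using genideal_minimal[OF zeroideal] by simp
  show "{0} \<subseteq> genideal G {}" using ideal_closed(1)[OF genideal_ideal[of "{}"]] by simp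
qed

lemma proper_ideal: "ideal I G \<Longrightarrow> I \<noteq> carrier G \<Longrightarrow> 1 \<notin> I"
  using ideal.one_imp_carrier[of I G] by auto

text \<open>
  An ideal containing \<open>f \<noteq> 0\<close> is generated by \<open>f\<close> together with a rational basis of its
  elements of degree at most \<open>deg f + t\<close>.
\<close>

lemma noetherian_G: "noetherian_ring G"
proof (rule noetherian_ringI)
  fix I assume I: "ideal I G"
  show "\<exists>A\<subseteq>carrier G. finite A \<and> I = genideal G A"
  proof (cases "I \<subseteq> {0}")
    case True
    hence "I = genideal G {}" using ideal_closed(1)[OF I] by (auto simp: genideal_empty)
    thus ?thesis by blast
  next
    case False
    then obtain f where f: "f \<in> I" "f \<noteq> 0" by blast
    note fC = subsetD[OF ideal_closed(2)[OF I] f(1)]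
    define W where "W = {p \<in> I. degree p \<le> degree f + t}"
    obtain B where B: "B \<subseteq> W" "rat_poly.independent B" "W \<subseteq> rat_poly.span B"
      using rat_poly.maximal_independent_subset by blast
    have "W \<subseteq> rat_poly.span (low_monomials (degree f + t))"
      using in_span_low_monomials ideal_closed(2)[OF I] by (auto simp: W_def)
    with B have "finite B"
      using rat_poly.independent_span_bound[OF finite_low_monomials] by blast
    define A where "A = insert f B"
    have A: "A \<subseteq> I" using f B(1) by (auto simp: A_def W_def)
    hence AC: "A \<subseteq> carrier G" using ideal_closed(2)[OF I] by blast
    note J = ideal_closed[OF genideal_ideal[OF AC]] genideal_self[OF AC]
    have "I \<subseteq> genideal G A"
    proof
      fix p assume p: "p \<in> I"
      obtain q where q: "q \<in> carrier G" "degree (p - q * f) \<le> degree f + t"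
        using division[OF fC f(2)] p ideal_closed(2)[OF I] by blast
      have "- q * f \<in> I" using f q by (intro ideal_closed(5)[OF I]) auto
      hence "p - q * f \<in> I" using ideal_closed(3)[OF I p] by fastforce
      hence "p - q * f \<in> rat_poly.span B" using B(3) q(2) by (auto simp: W_def)
      hence "p - q * f \<in> genideal G A"
      proof (induction rule: rat_poly.span_induct_alt)
        case base
        show ?case by (rule J(1))
      next
        case (step c x y)
        thus ?case using J(7) by (intro J(3) J(6)) (auto simp: A_def)
      qed
      moreover have "q * f \<in> genideal G A"
        using J(7) q(1) by (intro J(5)) (auto simp: A_def)
      ultimately have "(p - q * f) + q * f \<in> genideal G A" by (rule J(3))
      thus "p \<in> genideal G A" by simp
    qed
    moreover have "genideal G A \<subseteq> I" by (rule genideal_minimal[OF I A])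
    ultimately have "I = genideal G A" by (rule equalityI)
    moreover have "finite A" using \<open>finite B\<close> by (simp add: A_def)
    ultimately show ?thesis using AC by blast
  qed
qed

text \<open>
  If \<open>y \<notin> P\<close>, the factor \<open>y\<^sup>j\<close> cancels from \<open>y\<^sup>j (1 + y z) \<in> P\<close>, so \<open>1 + y z \<in> P\<close>: \<open>y\<close> is a
  unit modulo \<open>P\<close>.
\<close>

lemma nonzero_prime_maximal:
  assumes P: "primeideal P G" "P \<noteq> {0}" and J: "ideal J G" "P \<subset> J"
  shows "J = carrier G"
proof -
  interpret P: primeideal P G by fact
  note PI = ideal_closed[OF P.is_ideal] and JI = ideal_closed[OF J(1)]
  obtain f where f: "f \<in> P" "f \<noteq> 0" using P(2) PI(1) by blast
  obtain y where y: "y \<in> J" "y \<notin> P" using J(2) by blast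
  have fC: "f \<in> carrier G" and yC: "y \<in> carrier G" using f y PI(2) JI(2) by auto
  obtain j z g where z: "z \<in> carrier G" "g \<in> carrier G" "y ^ j * (1 + y * z) = f * g"
    by (rule power_relation[OF fC f(2) yC])
  have v: "1 + y * z \<in> carrier G" using yC z(1) by auto
  have "y ^ j * (1 + y * z) \<in> P" unfolding z(3) using f(1) z(2) by (rule PI(4))
  hence v_P: "1 + y * z \<in> P"
  proof (induction j)
    case (Suc j)
    have "y * (y ^ j * (1 + y * z)) \<in> P" using Suc.prems by (simp add: mult.assoc)
    hence "y ^ j * (1 + y * z) \<in> P"
      using P.I_prime[of y "y ^ j * (1 + y * z)"] y(2) yC v by auto
    thus ?case by (rule Suc.IH)
  qed simp
  have "P \<subseteq> J" using J(2) by blast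
  hence "1 + y * z \<in> J" using v_P by (rule subsetD)
  moreover have "y * - z \<in> J" using y(1) z(1) by (intro JI(4)) auto
  ultimately have "(1 + y * z) + y * - z \<in> J" by (rule JI(3))
  hence "1 \<in> J" by simp
  thus ?thesis using proper_ideal[OF J(1)] by blast
qed

definition irrelevant_ideal :: "complex poly set" where
  "irrelevant_ideal = {p \<in> carrier G. coeff p 0 = 0}"

lemma prime_irrelevant_ideal: "primeideal irrelevant_ideal G"
proof (rule primeidealI[OF idealI])
  show "subgroup irrelevant_ideal (add_monoid G)"
    by (rule add.subgroupI) (auto simp: irrelevant_ideal_def)
  have "1 \<notin> irrelevant_ideal" by (simp add: irrelevant_ideal_def)
  thus "carrier G \<noteq> irrelevant_ideal" by auto
qed (auto simp: irrelevant_ideal_def coeff_mult ring_axioms is_cring)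

lemma irrelevant_ideal_nonzero: "irrelevant_ideal \<noteq> {0}"
proof -
  have "Polynomial.monom 1 1 \<in> irrelevant_ideal" by (simp add: irrelevant_ideal_def)
  moreover have "Polynomial.monom 1 1 \<noteq> (0 :: complex poly)" by simp
  ultimately show ?thesis by blast
qed

lemma maximal_nonzero:
  assumes "maximalideal Q G"
  shows "Q \<noteq> {0}"
proof
  interpret maximalideal Q G by fact
  interpret irr: primeideal irrelevant_ideal G by (rule prime_irrelevant_ideal)
  assume "Q = {0}"
  hence "irrelevant_ideal = Q \<or> irrelevant_ideal = carrier G"
    using ideal_closed(1,2)[OF irr.is_ideal] by (intro I_maximal irr.is_ideal) auto
  thus False
    using irrelevant_ideal_nonzero irr.I_notcarr \<open>Q = {0}\<close> by blast
qed

lemma prime_chain_length: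
  assumes "prime_chain G n P"
  shows "n \<le> 1"
proof (rule ccontr)
  assume "\<not> n \<le> 1"
  hence P: "primeideal (P 0) G" "primeideal (P 1) G" "primeideal (P 2) G" "P 0 \<subset> P 1" "P 1 \<subset> P 2"
    using assms by (auto simp: prime_chain_def numeral_2_eq_2)
  have I: "ideal (P i) G" if "primeideal (P i) G" for i
    using that by (simp add: primeideal_def)
  have "0 \<in> P 0" by (rule ideal_closed(1)[OF I[OF P(1)]])
  hence "P 1 \<noteq> {0}" using P(4) by auto
  hence "P 2 = carrier G"
    using nonzero_prime_maximal[OF P(2) _ I[OF P(3)] P(5)] by blast
  thus False using primeideal.I_notcarr[OF P(3)] by blast
qed

lemma prime_chain_pair:
  assumes "primeideal Q G" "Q \<noteq> {0}"
  shows "prime_chain G 1 (\<lambda>i. if i = 0 then {0} else Q)"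
  using assms zeroprimeideal ideal_closed(1)[of Q]
  by (auto simp: prime_chain_def primeideal_def)

lemma krull_dim_G: "krull_dim G = 1"
  unfolding krull_dim_def
proof (rule antisym)
  show "Sup {enat n | n. \<exists>P. prime_chain G n P} \<le> 1"
    by (rule Sup_least) (auto dest: prime_chain_length simp: one_enat_def)
  show "1 \<le> Sup {enat n | n. \<exists>P. prime_chain G n P}"
    using prime_chain_pair[OF prime_irrelevant_ideal irrelevant_ideal_nonzero]
    by (intro Sup_upper) (auto simp: one_enat_def)
qed

lemma prime_height_maximal:
  assumes "maximalideal Q G"
  shows "prime_height G Q = 1"
  unfolding prime_height_def
proof (rule antisym)
  show "Sup {enat n | n. \<exists>P. prime_chain G n P \<and> P n = Q} \<le> 1"
    by (rule Sup_least) (auto dest: prime_chain_length simp: one_enat_def)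
  show "1 \<le> Sup {enat n | n. \<exists>P. prime_chain G n P \<and> P n = Q}"
    using prime_chain_pair[OF maximalideal_prime[OF assms] maximal_nonzero[OF assms]]
    by (intro Sup_upper) (force simp: one_enat_def)
qed

text \<open>
  The same cancellation as for primes: if \<open>y\<close> is regular modulo \<open>x\<close>, then \<open>1 + y z \<in> (x)\<close>, so
  \<open>x\<close> and \<open>y\<close> generate the unit ideal.
\<close>

lemma regular_sequence_length:
  assumes reg: "regular_sequence G xs" and Q: "ideal Q G" "1 \<notin> Q" "set xs \<subseteq> Q"
  shows "length xs \<le> 1"
proof (rule ccontr)
  assume "\<not> length xs \<le> 1"
  then obtain x y zs where xs: "xs = x # y # zs"
    by (cases xs; cases "tl xs") auto
  have x: "x \<in> carrier G" "x \<in> Q" and y: "y \<in> carrier G" "y \<in> Q"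
    using reg Q by (auto simp: regular_sequence_def xs)
  have regular: "\<And>w. w \<in> carrier G \<Longrightarrow> (xs ! i) * w \<in> genideal G (set (take i xs)) \<Longrightarrow>
      w \<in> genideal G (set (take i xs))" if "i < length xs" for i
    using reg that by (simp add: regular_sequence_def)
  have "x \<noteq> 0" using regular[of 0 1] by (auto simp: xs genideal_empty)
  have regular_y: "w \<in> genideal G {x}" if "w \<in> carrier G" "y * w \<in> genideal G {x}" for w
    using regular[of 1 w] that by (simp add: xs)
  obtain j z g where z: "z \<in> carrier G" "g \<in> carrier G" "y ^ j * (1 + y * z) = x * g"
    by (rule power_relation[OF x(1) \<open>x \<noteq> 0\<close> y(1)])
  have v: "1 + y * z \<in> carrier G" using y(1) z(1) by auto
  have Ix: "ideal (genideal G {x}) G" using x(1) by (intro genideal_ideal) simp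
  have "y ^ j * (1 + y * z) \<in> genideal G {x}"
    unfolding z(3) using genideal_self'[OF x(1)] z(2) by (rule ideal_closed(4)[OF Ix])
  hence "1 + y * z \<in> genideal G {x}"
  proof (induction j)
    case (Suc j)
    have "y * (y ^ j * (1 + y * z)) \<in> genideal G {x}" using Suc.prems by (simp add: mult.assoc)
    hence "y ^ j * (1 + y * z) \<in> genideal G {x}"
      by (rule regular_y[rotated]) (intro carrier_mult carrier_power v y(1))
    thus ?case by (rule Suc.IH)
  qed simp
  moreover have "genideal G {x} \<subseteq> Q" using x(2) by (intro genideal_minimal Q(1)) simp
  ultimately have "1 + y * z \<in> Q" by (rule rev_subsetD)
  moreover have "y * - z \<in> Q" using y(2) z(1) by (intro ideal_closed(4)[OF Q(1)]) auto
  ultimately have "(1 + y * z) + y * - z \<in> Q" by (rule ideal_closed(3)[OF Q(1)])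
  thus False using Q(2) by simp
qed

lemma ideal_depth_maximal:
  assumes Q: "maximalideal Q G"
  shows "ideal_depth G Q = 1"
  unfolding ideal_depth_def
proof (rule antisym)
  interpret Q: maximalideal Q G by fact
  have Q1: "1 \<notin> Q" using proper_ideal[OF Q.is_ideal] Q.I_notcarr by blast
  show "Sup {enat (length xs) | xs. regular_sequence G xs \<and> set xs \<subseteq> Q} \<le> 1"
    by (rule Sup_least) (auto dest: regular_sequence_length[OF _ Q.is_ideal Q1] simp: one_enat_def)
  obtain f where f: "f \<in> Q" "f \<noteq> 0"
    using maximal_nonzero[OF Q] ideal_closed(1)[OF Q.is_ideal] by blast
  have fC: "f \<in> carrier G" using f(1) by (rule Q.Icarr)
  have "genideal G {f} \<subseteq> Q" using f(1) by (intro genideal_minimal Q.is_ideal) simp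
  hence "genideal G {f} \<noteq> carrier G" using Q1 by auto
  hence "regular_sequence G [f]"
    using f(2) fC by (auto simp: regular_sequence_def genideal_empty)
  thus "1 \<le> Sup {enat (length xs) | xs. regular_sequence G xs \<and> set xs \<subseteq> Q}"
    using f(1) by (intro Sup_upper CollectI exI[of _ "[f]"]) (simp add: one_enat_def)
qed

lemma cohen_macaulay_G: "cohen_macaulay G"
  unfolding cohen_macaulay_def
  using is_cring noetherian_G ideal_depth_maximal prime_height_maximal by simp

lemma standard_G_domain_G: "standard_G_domain G G_comp"
proof (intro standard_G_domain.intro standard_G_algebra.intro standard_G_algebra_axioms.intro)
  show "x \<otimes>\<^bsub>G\<^esub> y \<in> G_comp (m + n)" if "x \<in> G_comp m" "y \<in> G_comp n" for x y m n
    using that by (auto simp: G_comp_iff mult_monom intro: V_mult)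
  show "finite_dimension (G_comp 0) (G_comp 1)"
    by (rule finite_dimensionI[OF dimension_G_comp])
qed (fact noetherian_G is_cring G_comp_subgroup direct_sum_G subfield_G_comp_0
      generate_ring_G domain_axioms)+

lemma is_h_vector_G:
  assumes "card (layer N S t) \<noteq> 0"
  shows "is_h_vector G G_comp (map (\<lambda>j. card (layer N S j)) [0..<Suc t])"
  unfolding is_h_vector_def
proof (intro conjI allI)
  show "last (map (\<lambda>j. card (layer N S j)) [0..<Suc t]) \<noteq> 0" using assms by simp
  fix i
  have "fps_nth (h_series G G_comp) i = int (card (layer N S i))"
  proof (cases i)
    case 0
    thus ?thesis
      by (simp add: h_series_def krull_dim_G hilbert_fun_G card_layer_0 one_enat_def)
  next
    case (Suc n)
    thus ?thesis
      using card_layer_Suc[OF N_pos zero_in_S, of n]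
      by (simp add: h_series_def krull_dim_G hilbert_fun_G one_enat_def algebra_simps
          fps_X_mult_nth del: sumset.simps)
  qed
  moreover have "layer N S i = {}" if "\<not> i < Suc t"
  proof -
    have "sumset N S i \<subseteq> sumset N S t"
      unfolding sumset_top using sumset_less[OF N_pos] by auto
    moreover have "t < i" using that by simp
    ultimately show ?thesis unfolding layer_def by blast
  qed
  ultimately show "fps_nth (h_series G G_comp) i =
      (if i < length (map (\<lambda>j. card (layer N S j)) [0..<Suc t])
       then int (map (\<lambda>j. card (layer N S j)) [0..<Suc t] ! i) else 0)"
    by (auto simp del: upt_Suc)
qed simp

end

section \<open>Coin systems\<close>

abbreviation realizable :: "nat list \<Rightarrow> bool" where
  "realizable h \<equiv> O_sequence h \<and>
    (\<exists>(R :: ambient ring) A. standard_G_domain R A \<and> cohen_macaulay R \<and> is_h_vector R A h)"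

lemma h_vector_by_distance:
  fixes D :: "nat list" and as :: "nat list"
  assumes D: "D = (map Suc (fold (map2 min) (map (\<lambda>a. rotate (length D - a) D) as) D))[0 := 0]"
    and as: "\<forall>a\<in>set as. a < length D" "0 \<in> set as"
    and t: "\<forall>d\<in>set D. d \<le> t" "t \<in> set D"
    and h: "h = map (count_list D) [0..<Suc t]"
  shows "realizable h"
proof -
  have pos: "0 < length D" using t(2) by (cases D) auto
  have as_le: "\<forall>a\<in>set as. a \<le> length D" using as(1) by auto
  note sumset = sumset_by_distance[OF as_le as(2) refl pos D]
  have layers: "card (layer (length D) (set as) j) = count_list D j" for j
    by (rule card_layer_by_distance[OF sumset refl])
  have h_eq: "h = map (\<lambda>j. card (layer (length D) (set as) j)) [0..<Suc t]"
    by (simp add: h layers)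
  have "O_sequence h"
    unfolding h_eq using pos as(2) by (intro O_sequence_layers) auto
  have "sumset (length D) (set as) t = {..<length D}"
    unfolding sumset using t(1) by auto
  then interpret sumset_domain "length D" "set as" t
    using pos as by unfold_locales auto
  have "card (layer (length D) (set as) t) \<noteq> 0"
    unfolding layers using t(2) by (simp add: count_list_0_iff)
  hence "is_h_vector G G_comp h"
    unfolding h_eq by (rule is_h_vector_G)
  with \<open>O_sequence h\<close> standard_G_domain_G cohen_macaulay_G show ?thesis by blast
qed

text \<open>
  For \<open>2 \<le> s\<close> the witness consists of the residues \<open>(3\<^sup>k - 1) / 2\<close>, \<open>k < s\<close>, modulo
  \<open>(3\<^sup>s - 1) / 2\<close>. With the coins \<open>1, 4, 13, 40, \<dots>\<close> greedy change uses the fewest coins, and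
  the computations below confirm that fewer do not suffice modulo \<open>(3\<^sup>s - 1) / 2\<close> either. Of a
  coin \<open>c\<close> at most three are used, and three of them only for the amount \<open>3 c\<close>, one less than the
  next coin. This gives the recursion for the number of coins.
\<close>

primrec coin_distances :: "nat \<Rightarrow> nat list" where
  "coin_distances 0 = [0]"
| "coin_distances (Suc n) = (let D = coin_distances n in D @ map Suc D @ map (\<lambda>d. d + 2) D @ [3])"

text \<open>
  For \<open>s = 1\<close> the coin system is the trivial group, whose \<open>h\<close>-vector is too short, so two
  residues modulo 2 take its place.
\<close>

lemma realizable_1: "realizable [1, 1]"
  by (rule h_vector_by_distance[of "[0, 1]" "[0, 1]" 1]; code_simp)

lemma realizable_2: "realizable [1, 1, 1, 1]"
  by (rule h_vector_by_distance[of "coin_distances 1" "[0, 1]" 3]; code_simp)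

lemma realizable_3: "realizable [1, 2, 3, 4, 2, 1]"
  by (rule h_vector_by_distance[of "coin_distances 2" "[0, 1, 4]" 5]; code_simp)

lemma realizable_4: "realizable [1, 3, 6, 10, 9, 7, 3, 1]"
  by (rule h_vector_by_distance[of "coin_distances 3" "[0, 1, 4, 13]" 7]; code_simp)

lemma realizable_5: "realizable [1, 4, 10, 20, 25, 26, 19, 11, 4, 1]"
  by (rule h_vector_by_distance[of "coin_distances 4" "[0, 1, 4, 13, 40]" 9]; code_simp)

theorem mainTheorem1:
  fixes s :: nat
  assumes "1 \<le> s" and "s \<le> 5"
  shows "\<exists>h :: nat list.
    length h = 2 * s \<and>
    O_sequence h \<and>
    (\<forall>i. i + 1 \<le> s - 1 \<longrightarrow> h ! i \<le> h ! (i + 1)) \<and>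
    h ! (2 * s - 1) = h ! 0 \<and> h ! (2 * s - 2) = h ! 1 \<and>
    (\<forall>i. 2 \<le> i \<and> i \<le> s - 1 \<longrightarrow> int (h ! (2 * s - 1 - i)) = int (h ! i) + (-1) ^ i) \<and>
    (\<exists>(R :: ambient ring) A.
       standard_G_domain R A \<and> cohen_macaulay R \<and> is_h_vector R A h)"
proof -
  have reduce: ?thesis
    if h: "length h = 2 * s" "realizable h" "\<forall>i<s - 1. h ! i \<le> h ! Suc i"
      "h ! (2 * s - 1) = h ! 0" "h ! (2 * s - 2) = h ! 1"
      "\<forall>i<s. 2 \<le> i \<longrightarrow> int (h ! (2 * s - 1 - i)) = int (h ! i) + (-1) ^ i" for h
  proof (intro exI[of _ h] conjI allI impI)
    show "h ! i \<le> h ! (i + 1)" if "i + 1 \<le> s - 1" for i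
      using h(3) that by simp
    show "int (h ! (2 * s - 1 - i)) = int (h ! i) + (-1) ^ i" if "2 \<le> i \<and> i \<le> s - 1" for i
      using h(6) that assms(1) by auto
  qed (use h in auto)
  consider "s = 1" | "s = 2" | "s = 3" | "s = 4" | "s = 5" using assms by linarith
  thus ?thesis
  proof cases
    case 1
    show ?thesis
      by (rule reduce[OF _ realizable_1]) (simp_all add: 1 All_less_Suc numeral_eq_Suc)
  next
    case 2
    show ?thesis
      by (rule reduce[OF _ realizable_2]) (simp_all add: 2 All_less_Suc numeral_eq_Suc)
  next
    case 3
    show ?thesis
      by (rule reduce[OF _ realizable_3]) (simp_all add: 3 All_less_Suc numeral_eq_Suc)
  next
    case 4
    show ?thesis
      by (rule reduce[OF _ realizable_4]) (simp_all add: 4 All_less_Suc numeral_eq_Suc)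
  next
    case 5
    show ?thesis
      by (rule reduce[OF _ realizable_5]) (simp_all add: 5 All_less_Suc numeral_eq_Suc)
  qed
qed

end
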